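(* Let $\mathcal H$ be a real Hilbert space, let $f\in\Gamma_0(\mathcal H)$ be such that $\operatorname{lev}_{\leq 0}f\neq\varnothing$, let $\Omega$ be an open convex set contained in $\{x\in\mathcal H: 0<f(x)<+\infty\}$, and let $\beta\in\,]0,+\infty[$. Suppose that $f$ is twice Fréchet differentiable on $\Omega$. If $\sup_{x\in\Omega}|f(x)|<+\infty$, $\nabla f$ is $\beta$-Lipschitz on $\Omega$ and $\inf_{x\in\Omega}\|\nabla f(x)\|>0$, then $G_f$ is $\beta'$-Lipschitz on $\operatorname{lev}_{\leq 0}f\cup\Omega$, where $$\beta'=2+3\,\frac{\sup_{x\in\Omega}|f(x)|}{\inf_{x\in\Omega}\|\nabla f(x)\|^2}\,\beta .$$
   Context: $\Gamma_0(\mathcal H)$ is the set of proper convex lower semicontinuous functions $\mathcal H\to]-\infty,+\infty]$; $\operatorname{lev}_{\leq 0}f=\{x: f(x)\leq 0\}$. $\partial f$ is the convex subdifferential. The subgradient projector $G_f:\mathcal H\to 2^{\mathcal H}$ is $G_fx=\{x\}$ if $f(x)\leq 0$ and $G_fx=\{x-\frac{f(x)}{\|u\|^2}u : u\in\partial f(x)\}$ if $f(x)>0$ (subgradients at points where $f>0$ are nonzero because $\operatorname{lev}_{\leq 0}f\neq\varnothing$); singletons are identified with their element, so that on $\operatorname{lev}_{\leq 0}f\cup\Omega$ the operator $G_f$ is single-valued. *)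

theory Defs
  imports "HOL-Analysis.Analysis"
begin

definition lev_le0 :: "('a \<Rightarrow> ereal) \<Rightarrow> 'a set" where
  "lev_le0 f = {x. f x \<le> 0}"

definition proper_fun :: "('a \<Rightarrow> ereal) \<Rightarrow> bool" where
  "proper_fun f \<longleftrightarrow> (\<forall>x. f x \<noteq> -\<infinity>) \<and> (\<exists>x. f x \<noteq> \<infinity>)"

text \<open>The library's \<^const>\<open>convex_on\<close> only covers real-valued functions. The weights are strictly
  positive, so that the product \<open>0 * \<infinity>\<close> never arises.\<close>

definition convex_fun :: "('a::real_vector \<Rightarrow> ereal) \<Rightarrow> bool" where
  "convex_fun f \<longleftrightarrow>
     (\<forall>x y. \<forall>t::real. 0 < t \<and> t < 1 \<longrightarrow>
        f ((1 - t) *\<^sub>R x + t *\<^sub>R y) \<le> ereal (1 - t) * f x + ereal t * f y)"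

definition lsc_fun :: "('a::topological_space \<Rightarrow> ereal) \<Rightarrow> bool" where
  "lsc_fun f \<longleftrightarrow> (\<forall>x. f x \<le> Liminf (at x) f)"

definition Gamma0 :: "('a::{real_inner, complete_space} \<Rightarrow> ereal) set" where
  "Gamma0 = {f. proper_fun f \<and> convex_fun f \<and> lsc_fun f}"

definition subdifferential :: "('a::real_inner \<Rightarrow> ereal) \<Rightarrow> 'a \<Rightarrow> 'a set" where
  "subdifferential f x = {u. \<forall>y. f x + ereal (inner (y - x) u) \<le> f y}"

text \<open>For proper \<open>f\<close> and \<open>f x = \<infinity>\<close> the subdifferential is empty, so the coercion
  \<^const>\<open>real_of_ereal\<close> only ever acts on finite values.\<close>

definition subgradient_projector :: "('a::real_inner \<Rightarrow> ereal) \<Rightarrow> 'a \<Rightarrow> 'a set" where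
  "subgradient_projector f x =
     (if f x \<le> 0 then {x}
      else {x - (real_of_ereal (f x) / (norm u)\<^sup>2) *\<^sub>R u | u. u \<in> subdifferential f x})"

text \<open>Differentiability and gradients of an extended-real-valued function are those of its real
  part; they are only used on an open set on which the function is finite.\<close>

definition gradient :: "('a::real_inner \<Rightarrow> ereal) \<Rightarrow> 'a \<Rightarrow> 'a" where
  "gradient f x = (THE g. GDERIV (\<lambda>y. real_of_ereal (f y)) x :> g)"

definition twice_frechet_differentiable_on ::
    "('a::real_normed_vector \<Rightarrow> ereal) \<Rightarrow> 'a set \<Rightarrow> bool" where
  "twice_frechet_differentiable_on f S \<longleftrightarrow>
     (\<exists>D :: 'a \<Rightarrow> ('a \<Rightarrow>\<^sub>L real). \<forall>x\<in>S.
        ((\<lambda>y. real_of_ereal (f y)) has_derivative blinfun_apply (D x)) (at x) \<and>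
        D differentiable (at x))"

text \<open>Supremum and infimum are taken in \<^typ>\<open>ereal\<close>, so that their finiteness and positivity can be
  stated as hypotheses. For empty \<open>\<Omega>\<close> they are \<open>-\<infinity>\<close> and \<open>\<infinity>\<close>, which \<^const>\<open>real_of_ereal\<close> sends
  to 0; the quotient is then 0 and the constant is 2.\<close>

definition sup_abs :: "('a \<Rightarrow> ereal) \<Rightarrow> 'a set \<Rightarrow> ereal" where
  "sup_abs f \<Omega> = (SUP x\<in>\<Omega>. \<bar>f x\<bar>)"

definition inf_norm_gradient :: "('a::real_inner \<Rightarrow> ereal) \<Rightarrow> 'a set \<Rightarrow> ereal" where
  "inf_norm_gradient f \<Omega> = (INF x\<in>\<Omega>. ereal (norm (gradient f x)))"

definition lipschitz_bound :: "('a::real_inner \<Rightarrow> ereal) \<Rightarrow> 'a set \<Rightarrow> real \<Rightarrow> real" where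
  "lipschitz_bound f \<Omega> \<beta> =
     2 + 3 * (real_of_ereal (sup_abs f \<Omega>) / (real_of_ereal (inf_norm_gradient f \<Omega>))\<^sup>2) * \<beta>"

end

(* On \<Omega> write g for the gradient of f and H for its derivative. Then G_f x = x - f(x)/|g|^2 g is
   differentiable with derivative P - (f/|g|^2) Q H, where P is the orthogonal projection onto the
   complement of g and Q is the reflection in it. Since |P| \<le> 1, Q is an isometry and |H| \<le> \<beta>, the
   operator is (1 + sup |f| \<beta> / inf |g|^2)-Lipschitz on the convex set \<Omega>. For y in \<Omega>, G_f y is the
   projection of y onto a half-space that contains the level set, so G_f does not increase the
   distance from y to a point of the level set. *)
theory Submission
  imports Defs
begin

section \<open>Riesz representation in a real Hilbert space\<close>

text \<open>The representing vector is the minimizer of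
  \<open>J x = (norm x)\<^sup>2 / 2 - \<phi> x\<close>. Completeness yields the minimizer as the
  limit of a minimizing sequence, and the first-order condition there is the claim.\<close>

lemma riesz_representation:
  fixes \<phi> :: "'a::{real_inner, complete_space} \<Rightarrow> real"
  assumes "bounded_linear \<phi>"
  obtains g where "\<And>h. inner g h = \<phi> h"
proof -
  interpret \<phi>: bounded_linear \<phi> by fact
  define J where "J x = (norm x)\<^sup>2 / 2 - \<phi> x" for x
  obtain K where K: "\<And>x. norm (\<phi> x) \<le> norm x * K"
    using \<phi>.bounded by blast
  have "- (K\<^sup>2 / 2) \<le> J x" for x
  proof -
    have "\<phi> x \<le> norm x * K"
      using K[of x] by simp
    moreover have "0 \<le> (norm x - K)\<^sup>2"
      by simp
    ultimately show ?thesis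
      unfolding J_def power2_diff by (simp add: field_simps)
  qed
  then have bdd: "bdd_below (range J)"
    by (auto intro!: bdd_belowI2)
  define I where "I = Inf (range J)"
  have I_le: "I \<le> J x" for x
    unfolding I_def by (rule cInf_lower) (use bdd in auto)
  have "\<exists>x. J x < I + inverse (real (Suc n))" for n
    using cInf_lessD[of "range J" "I + inverse (real (Suc n))"] by (auto simp: I_def)
  then obtain X where X: "\<And>n. J (X n) < I + inverse (real (Suc n))"
    by metis
  \<comment> \<open>By the parallelogram law a minimizing sequence is Cauchy.\<close>
  have parallelogram: "(norm (x - y))\<^sup>2 / 4 = J x + J y - 2 * J ((1/2) *\<^sub>R (x + y))" for x y
    unfolding J_def power2_norm_eq_inner
    by (simp add: \<phi>.scaleR \<phi>.add inner_add_left inner_add_right inner_diff_left inner_diff_right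
        inner_commute[of y x] dot_square_norm[symmetric] del: dot_square_norm) (simp add: field_simps)
  have "Cauchy X"
  proof (rule metric_CauchyI)
    fix e :: real
    assume "0 < e"
    \<comment> \<open>Both values of \<open>J\<close> will lie within e^2/8 of the infimum while the
      midpoint value is at least \<open>I\<close>, so the parallelogram identity leaves less than 2
      * e^2/8 = e^2/4.\<close>
    then obtain N where N: "inverse (real (Suc N)) < e\<^sup>2 / 8"
      using reals_Archimedean[of "e\<^sup>2 / 8"] by auto
    show "\<exists>M. \<forall>m\<ge>M. \<forall>n\<ge>M. dist (X m) (X n) < e"
    proof (intro exI allI impI)
      fix m n
      assume "N \<le> m" "N \<le> n"
      then have "inverse (real (Suc m)) \<le> inverse (real (Suc N))"
        "inverse (real (Suc n)) \<le> inverse (real (Suc N))"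
        by (simp_all add: le_imp_inverse_le)
      then have "(norm (X m - X n))\<^sup>2 / 4 < e\<^sup>2 / 4"
        using parallelogram[of "X m" "X n"] X[of m] X[of n] N
          I_le[of "(1/2) *\<^sub>R (X m + X n)"] by linarith
      then show "dist (X m) (X n) < e"
        using \<open>0 < e\<close> by (simp add: dist_norm power2_less_imp_less)
    qed
  qed
  then obtain g where g: "X \<longlonglongrightarrow> g"
    using Cauchy_convergent_iff convergent_def by blast
  have "(\<lambda>n. J (X n)) \<longlonglongrightarrow> J g"
    unfolding J_def by (intro tendsto_intros \<phi>.tendsto g) simp
  moreover have "(\<lambda>n. I + inverse (real (Suc n))) \<longlonglongrightarrow> I + 0"
    by (intro tendsto_add tendsto_const LIMSEQ_inverse_real_of_nat)
  ultimately have "J g \<le> I + 0"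
    by (rule LIMSEQ_le) (use X less_imp_le in blast)
  then have min: "J g \<le> J x" for x
    using I_le[of x] by linarith
  have "inner g h = \<phi> h" for h
  proof (cases "h = 0")
    case False
    define c where "c = inner g h - \<phi> h"
    \<comment> \<open>This \<open>t\<close> minimizes the quadratic
      \<open>J (g + t *\<^sub>R h)\<close> in \<open>t\<close>. It would lower \<open>J\<close> by
      c^2 / (2 |h|^2), so minimality of \<open>g\<close> forces \<open>c = 0\<close>.\<close>
    define t where "t = - c / (norm h)\<^sup>2"
    have "J (g + t *\<^sub>R h) - J g = t * c + t\<^sup>2 * (norm h)\<^sup>2 / 2"
      unfolding J_def c_def power2_norm_eq_inner
      by (simp add: \<phi>.scaleR \<phi>.add inner_add_left inner_add_right inner_commute[of h g])
        (simp add: field_simps power2_eq_square)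
    also have "\<dots> = - c\<^sup>2 / (2 * (norm h)\<^sup>2)"
      using False by (simp add: t_def field_simps power2_eq_square)
    finally have "0 \<le> - c\<^sup>2 / (2 * (norm h)\<^sup>2)"
      using min[of "g + t *\<^sub>R h"] by linarith
    then have "c\<^sup>2 \<le> 0"
      using False by (simp add: field_simps)
    then show ?thesis
      by (simp add: c_def)
  qed (simp add: \<phi>.zero)
  then show thesis
    by (rule that)
qed

text \<open>Second-order differentiability is stated for the dual-valued derivative. A bounded
  linear Riesz map transfers it to the gradient by composition. Linearity comes from uniqueness of
  the representing vector, the norm bound from testing \<phi> on \<open>R \<phi>\<close>
  itself.\<close>

lemma riesz_map:
  obtains R :: "('a::{real_inner, complete_space} \<Rightarrow>\<^sub>L real) \<Rightarrow> 'a"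
  where "bounded_linear R" "\<And>\<phi> h. inner (R \<phi>) h = blinfun_apply \<phi> h"
proof -
  have "\<exists>g. \<forall>h. inner g h = blinfun_apply \<phi> h" for \<phi> :: "'a \<Rightarrow>\<^sub>L real"
    using riesz_representation[OF blinfun.bounded_linear_right[of \<phi>]] by metis
  then obtain R :: "('a \<Rightarrow>\<^sub>L real) \<Rightarrow> 'a" where R: "\<And>\<phi> h. inner (R \<phi>) h = blinfun_apply \<phi> h"
    by metis
  have ext: "x = y" if "\<And>h. inner x h = inner y h" for x y :: 'a
    using that vector_eq_rdot[of x y] by simp
  have "bounded_linear R"
  proof (rule bounded_linear_intro)
    show "R (\<phi> + \<psi>) = R \<phi> + R \<psi>" for \<phi> \<psi>
      by (rule ext) (simp add: R inner_add_left blinfun.add_left)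
    show "R (r *\<^sub>R \<phi>) = r *\<^sub>R R \<phi>" for r \<phi>
      by (rule ext) (simp add: R blinfun.scaleR_left)
    show "norm (R \<phi>) \<le> norm \<phi> * 1" for \<phi>
    proof (cases "R \<phi> = 0")
      case False
      have "norm (R \<phi>) * norm (R \<phi>) = blinfun_apply \<phi> (R \<phi>)"
        by (simp add: R[symmetric] power2_norm_eq_inner[symmetric] power2_eq_square)
      also have "\<dots> \<le> norm \<phi> * norm (R \<phi>)"
        using norm_blinfun[of \<phi> "R \<phi>"] by simp
      finally show ?thesis
        using False by simp
    qed simp
  qed
  then show thesis
    using R by (rule that)
qed

section \<open>One-sided difference quotients, subgradients and Lipschitz bounds\<close>

lemma has_derivative_directional_limit:
  assumes "(f has_derivative f') (at x)"
  shows "((\<lambda>t. (f (x + t *\<^sub>R h) - f x) /\<^sub>R t) \<longlongrightarrow> f' h) (at_right 0)"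
proof -
  have "((\<lambda>t. f (x + t *\<^sub>R h)) has_derivative (\<lambda>t. f' (t *\<^sub>R h))) (at 0 within {0<..})"
    by (rule has_derivative_compose[of "\<lambda>t. x + t *\<^sub>R h" "\<lambda>t. t *\<^sub>R h" 0 _ f f'])
      (use assms in \<open>auto intro!: derivative_eq_intros\<close>)
  then have "((\<lambda>t. (1 / norm (t - 0)) *\<^sub>R (f (x + t *\<^sub>R h) - (f (x + 0 *\<^sub>R h) + f' ((t - 0) *\<^sub>R h))))
      \<longlongrightarrow> 0) (at_right 0)"
    by (simp only: has_derivative_within)
  moreover have "f' (t *\<^sub>R h) = t *\<^sub>R f' h" for t
    using assms by (simp add: has_derivative_bounded_linear linear_simps(5))
  ultimately have "((\<lambda>t. (1 / norm t) *\<^sub>R (f (x + t *\<^sub>R h) - (f x + t *\<^sub>R f' h))) \<longlongrightarrow> 0) (at_right 0)"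
    by simp
  \<comment> \<open>For positive \<open>t\<close> the factor \<open>norm t\<close> is
    \<open>t\<close>, so the Frechet remainder becomes the difference quotient minus
    \<open>f' h\<close>.\<close>
  moreover have "eventually (\<lambda>t. (1 / norm t) *\<^sub>R (f (x + t *\<^sub>R h) - (f x + t *\<^sub>R f' h)) =
      (f (x + t *\<^sub>R h) - f x) /\<^sub>R t - f' h) (at_right 0)"
    using eventually_at_right_less[of 0]
    by eventually_elim (simp add: inverse_eq_divide diff_diff_eq[symmetric] scaleR_diff_right)
  ultimately have "((\<lambda>t. (f (x + t *\<^sub>R h) - f x) /\<^sub>R t - f' h) \<longlongrightarrow> 0) (at_right 0)"
    by (simp cong: tendsto_cong)
  then show ?thesis
    by (simp add: LIM_zero_iff)
qed

text \<open>By convexity the difference quotients towards \<open>y\<close> are at most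
  \<open>F y - F x\<close>, and their limit makes \<open>g\<close> a subgradient. Conversely, a
  subgradient \<open>u\<close> bounds the quotients from below in every direction, so <h, u> is at
  most <h, g> for all \<open>h\<close>, and \<open>h = u - g\<close> gives equality.\<close>

lemma subdifferential_eq_gradient:
  fixes f :: "'a::real_inner \<Rightarrow> ereal"
  assumes "convex_fun f" "proper_fun f" "open S" "x \<in> S"
    and fin: "\<And>y. y \<in> S \<Longrightarrow> f y < \<infinity>"
    and deriv: "GDERIV (\<lambda>y. real_of_ereal (f y)) x :> g"
  shows "subdifferential f x = {g}"
proof -
  define F where "F y = real_of_ereal (f y)" for y
  have F: "f y = ereal (F y)" if "f y < \<infinity>" for y
    using that assms(2) by (auto simp: F_def proper_fun_def ereal_real)
  have fx: "f x = ereal (F x)"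
    using F fin \<open>x \<in> S\<close> by blast
  have "(F has_derivative (\<lambda>h. inner h g)) (at x)"
    using deriv by (simp add: gderiv_def F_def[abs_def])
  then have lim: "((\<lambda>t. (F (x + t *\<^sub>R h) - F x) /\<^sub>R t) \<longlongrightarrow> inner h g) (at_right 0)" for h
    by (rule has_derivative_directional_limit)
  have "g \<in> subdifferential f x"
    unfolding subdifferential_def
  proof (intro CollectI allI)
    fix y
    show "f x + ereal (inner (y - x) g) \<le> f y"
    proof (cases "f y < \<infinity>")
      case True
      have "(F (x + t *\<^sub>R (y - x)) - F x) /\<^sub>R t \<le> F y - F x" if "0 < t" "t < 1" for t
      proof -
        have "f (x + t *\<^sub>R (y - x)) = f ((1 - t) *\<^sub>R x + t *\<^sub>R y)"
          by (simp add: algebra_simps)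
        also have "\<dots> \<le> ereal (1 - t) * f x + ereal t * f y"
          using assms(1) that by (simp add: convex_fun_def)
        also have "\<dots> = ereal ((1 - t) * F x + t * F y)"
          using F[OF True] fx by simp
        finally have le: "f (x + t *\<^sub>R (y - x)) \<le> ereal ((1 - t) * F x + t * F y)" .
        \<comment> \<open>The segment to \<open>y\<close> may leave \<open>S\<close>, so finiteness
          of \<open>f\<close> on it is read off from the convexity bound instead of
          \<open>fin\<close>.\<close>
        then have "f (x + t *\<^sub>R (y - x)) < \<infinity>"
          by (auto simp: less_top[symmetric])
        with le have "F (x + t *\<^sub>R (y - x)) \<le> (1 - t) * F x + t * F y"
          using F[of "x + t *\<^sub>R (y - x)"] by (metis ereal_less_eq(3))
        then show ?thesis
          using that by (simp add: field_simps)
      qed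
      then have "eventually (\<lambda>t. (F (x + t *\<^sub>R (y - x)) - F x) /\<^sub>R t \<le> F y - F x) (at_right 0)"
        using eventually_at_right_less[of 0]
        by (auto simp: eventually_at_right_field intro!: exI[of _ 1])
      then have "inner (y - x) g \<le> F y - F x"
        by (rule tendsto_upperbound[OF lim]) simp
      then show ?thesis
        using F[OF True] fx by simp
    qed simp
  qed
  moreover have "u = g" if u: "u \<in> subdifferential f x" for u
  proof -
    have le: "inner h u \<le> inner h g" for h
    proof (rule tendsto_lowerbound[OF lim])
      have "((\<lambda>t. x + t *\<^sub>R h) \<longlongrightarrow> x + 0 *\<^sub>R h) (at_right 0)"
        by (intro tendsto_intros)
      then have "eventually (\<lambda>t. x + t *\<^sub>R h \<in> S) (at_right 0)"
        using \<open>open S\<close> \<open>x \<in> S\<close> by (auto elim!: topological_tendstoD)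
      then show "eventually (\<lambda>t. inner h u \<le> (F (x + t *\<^sub>R h) - F x) /\<^sub>R t) (at_right 0)"
        using eventually_at_right_less[of 0]
      proof eventually_elim
        case (elim t)
        have "f x + ereal (inner (t *\<^sub>R h) u) \<le> f (x + t *\<^sub>R h)"
          using u unfolding subdifferential_def by (metis (mono_tags, lifting) add_diff_cancel_left' mem_Collect_eq)
        then show ?case
          using F[OF fin[OF elim(1)]] fx elim(2) by (simp add: field_simps)
      qed
    qed simp
    have "inner (u - g) (u - g) \<le> 0"
      using le[of "u - g"] by (simp add: inner_diff_right)
    then show "u = g"
      by (metis eq_iff_diff_eq_0 inner_eq_zero_iff inner_ge_zero order_antisym)
  qed
  ultimately show ?thesis
    by blast
qed

text \<open>Openness keeps \<open>x + t *\<^sub>R h\<close> in \<open>S\<close> for small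
  \<open>t\<close>, where the Lipschitz condition bounds the difference quotients; the bound
  survives the limit.\<close>

lemma has_derivative_norm_le_lipschitz:
  fixes f :: "'a::real_normed_vector \<Rightarrow> 'b::real_normed_vector"
  assumes "L-lipschitz_on S f" "open S" "x \<in> S" "(f has_derivative f') (at x)"
  shows "norm (f' h) \<le> L * norm h"
proof (rule tendsto_upperbound)
  show "((\<lambda>t. norm ((f (x + t *\<^sub>R h) - f x) /\<^sub>R t)) \<longlongrightarrow> norm (f' h)) (at_right 0)"
    by (intro tendsto_norm has_derivative_directional_limit assms)
  have "((\<lambda>t. x + t *\<^sub>R h) \<longlongrightarrow> x + 0 *\<^sub>R h) (at_right 0)"
    by (intro tendsto_intros)
  then have "eventually (\<lambda>t. x + t *\<^sub>R h \<in> S) (at_right 0)"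
    using assms by (auto elim!: topological_tendstoD)
  then show "eventually (\<lambda>t. norm ((f (x + t *\<^sub>R h) - f x) /\<^sub>R t) \<le> L * norm h) (at_right 0)"
    using eventually_at_right_less[of 0]
  proof eventually_elim
    case (elim t)
    then have "norm (f (x + t *\<^sub>R h) - f x) \<le> L * norm (t *\<^sub>R h)"
      using lipschitz_onD[OF assms(1) elim(1) assms(3)] by (simp add: dist_norm)
    then show ?case
      using elim(2) by (simp add: divide_inverse_commute[symmetric] pos_divide_le_eq mult_ac)
  qed
qed simp

section \<open>Projection, reflection and half-space estimates\<close>

lemma power2_norm_diff_scaleR:
  fixes g v :: "'a::real_inner"
  shows "(norm (v - c *\<^sub>R g))\<^sup>2 = (norm v)\<^sup>2 - 2 * c * inner g v + c\<^sup>2 * (norm g)\<^sup>2"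
  unfolding power2_norm_eq_inner
  by (simp add: inner_diff_left inner_diff_right inner_commute[of v g] power2_eq_square
      right_diff_distrib)

text \<open>Pythagoras for the projection of \<open>v\<close> onto the orthogonal complement of
  \<open>g\<close>. For \<open>g = 0\<close> the subtracted term vanishes.\<close>

lemma norm_diff_projection_le:
  fixes g v :: "'a::real_inner"
  shows "norm (v - (inner g v / (norm g)\<^sup>2) *\<^sub>R g) \<le> norm v"
proof (cases "g = 0")
  case False
  have "(norm (v - (inner g v / (norm g)\<^sup>2) *\<^sub>R g))\<^sup>2 = (norm v)\<^sup>2 - (inner g v)\<^sup>2 / (norm g)\<^sup>2"
    unfolding power2_norm_diff_scaleR using False by (simp add: field_simps power2_eq_square)
  also have "\<dots> \<le> (norm v)\<^sup>2"
    by simp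
  finally show ?thesis
    by (rule power2_le_imp_le) simp
qed simp

text \<open>With the doubled coefficient the last two terms of the expanded square cancel. The
  triangle inequality alone would give a factor 3 here.\<close>

lemma norm_reflection:
  fixes g v :: "'a::real_inner"
  shows "norm (v - (2 * inner g v / (norm g)\<^sup>2) *\<^sub>R g) = norm v"
proof (cases "g = 0")
  case False
  have "(norm (v - (2 * inner g v / (norm g)\<^sup>2) *\<^sub>R g))\<^sup>2 = (norm v)\<^sup>2"
    unfolding power2_norm_diff_scaleR using False by (simp add: field_simps power2_eq_square)
  then show ?thesis
    by (rule power2_eq_imp_eq) simp_all
qed simp

text \<open>The squared norm changes by a (2 <g, v> + a) / |g|^2, and 2 <g, v> + a is at most -a. It
  will be used with \<open>v = x - y\<close> and \<open>a = F y\<close>, for \<open>x\<close> in the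
  level set and \<open>y\<close> in \<Omega>.\<close>

lemma norm_add_halfspace_step_le:
  fixes g v :: "'a::real_inner"
  assumes "inner g v \<le> - a" "0 \<le> a"
  shows "norm (v + (a / (norm g)\<^sup>2) *\<^sub>R g) \<le> norm v"
proof (cases "g = 0")
  case False
  have "(norm (v - (- a / (norm g)\<^sup>2) *\<^sub>R g))\<^sup>2 = (norm v)\<^sup>2 + a * (2 * inner g v + a) / (norm g)\<^sup>2"
    unfolding power2_norm_diff_scaleR using False by (simp add: field_simps power2_eq_square)
  moreover have "a * (2 * inner g v + a) / (norm g)\<^sup>2 \<le> 0"
    using assms by (intro divide_nonpos_nonneg mult_nonneg_nonpos) auto
  ultimately have "(norm (v + (a / (norm g)\<^sup>2) *\<^sub>R g))\<^sup>2 \<le> (norm v)\<^sup>2"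
    by simp
  then show ?thesis
    by (rule power2_le_imp_le) simp
qed simp

section \<open>Derivative of the gradient step\<close>

text \<open>This is the quotient rule for \<open>F\<close> over |g|^2, regrouped so that the
  projection of \<open>h\<close> and the reflection of \<open>H h\<close> become visible and the
  preceding norm facts apply.\<close>

lemma has_derivative_gradient_step:
  fixes F :: "'a::real_inner \<Rightarrow> real"
  assumes F: "(F has_derivative (\<lambda>h. inner h (g x))) (at x)" and g: "(g has_derivative H) (at x)"
    and nz: "g x \<noteq> 0"
  shows "((\<lambda>y. y - (F y / (norm (g y))\<^sup>2) *\<^sub>R g y) has_derivative
    (\<lambda>h. (h - (inner (g x) h / (norm (g x))\<^sup>2) *\<^sub>R g x) -
      (F x / (norm (g x))\<^sup>2) *\<^sub>R (H h - (2 * inner (g x) (H h) / (norm (g x))\<^sup>2) *\<^sub>R g x))) (at x)"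
proof -
  define N where "N y = (norm (g y))\<^sup>2" for y
  have N: "(N has_derivative (\<lambda>h. 2 * inner (g x) (H h))) (at x)"
    unfolding N_def[abs_def] power2_norm_eq_inner
    by (rule has_derivative_eq_rhs[OF has_derivative_inner[OF g g]]) (simp add: inner_commute)
  have "N x \<noteq> 0"
    using nz by (simp add: N_def)
  have "((\<lambda>y. y - (F y / N y) *\<^sub>R g y) has_derivative
    (\<lambda>h. h - ((F x / N x) *\<^sub>R H h +
      ((inner h (g x) * N x - F x * (2 * inner (g x) (H h))) / (N x * N x)) *\<^sub>R g x))) (at x)"
    by (intro has_derivative_diff has_derivative_ident has_derivative_scaleR
        has_derivative_divide' F g N \<open>N x \<noteq> 0\<close>)
  then show ?thesis
    unfolding N_def[symmetric]
  proof (rule has_derivative_eq_rhs, intro ext)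
    fix h
    \<comment> \<open>The first summand completes the projection of \<open>h\<close>, the second the
      reflection of \<open>H h\<close>.\<close>
    have "(inner h (g x) * N x - F x * (2 * inner (g x) (H h))) / (N x * N x) =
        inner (g x) h / N x - F x / N x * (2 * inner (g x) (H h) / N x)"
      using \<open>N x \<noteq> 0\<close> by (simp add: field_simps inner_commute)
    then show "h - ((F x / N x) *\<^sub>R H h +
        ((inner h (g x) * N x - F x * (2 * inner (g x) (H h))) / (N x * N x)) *\<^sub>R g x) =
      (h - (inner (g x) h / N x) *\<^sub>R g x) -
        (F x / N x) *\<^sub>R (H h - (2 * inner (g x) (H h) / N x) *\<^sub>R g x)"
      by (simp only: scaleR_diff_left scaleR_diff_right scaleR_scaleR) simp
  qed
qed

section \<open>The Lipschitz estimate for the subgradient projector\<close>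

theorem proposition3p12:
  fixes f :: "'a::{real_inner, complete_space} \<Rightarrow> ereal"
    and \<Omega> :: "'a set"
    and \<beta> :: real
  assumes "f \<in> Gamma0"
    and "lev_le0 f \<noteq> {}"
    and "open \<Omega>"
    and "convex \<Omega>"
    and "\<Omega> \<subseteq> {x. 0 < f x \<and> f x < \<infinity>}"
    and "0 < \<beta>"
    and "twice_frechet_differentiable_on f \<Omega>"
    and "sup_abs f \<Omega> < \<infinity>"
    and "\<beta>-lipschitz_on \<Omega> (gradient f)"
    and "0 < inf_norm_gradient f \<Omega>"
  shows "\<exists>G. (\<forall>x \<in> lev_le0 f \<union> \<Omega>. subgradient_projector f x = {G x}) \<and>
             (lipschitz_bound f \<Omega> \<beta>)-lipschitz_on (lev_le0 f \<union> \<Omega>) G"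
proof -
  define F where "F x = real_of_ereal (f x)" for x
  have f_eq: "f x = ereal (F x)" if "x \<in> \<Omega>" for x
    using that assms(5) by (auto simp: F_def ereal_real)
  have F_pos: "0 < F x" if "x \<in> \<Omega>" for x
    using that assms(5) f_eq[OF that] by (metis (mono_tags, lifting) ereal_less(2) mem_Collect_eq subsetD)
  obtain D :: "'a \<Rightarrow> ('a \<Rightarrow>\<^sub>L real)"
    where D: "\<And>x. x \<in> \<Omega> \<Longrightarrow> (F has_derivative blinfun_apply (D x)) (at x)"
      and D': "\<And>x. x \<in> \<Omega> \<Longrightarrow> D differentiable (at x)"
    using assms(7) unfolding twice_frechet_differentiable_on_def F_def[abs_def] by blast
  obtain R :: "('a \<Rightarrow>\<^sub>L real) \<Rightarrow> 'a"
    where R: "bounded_linear R" "\<And>\<phi> h. inner (R \<phi>) h = blinfun_apply \<phi> h"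
    using riesz_map[where ?'a = 'a] by metis
  \<comment> \<open>As the composition of \<open>R\<close> with \<open>D\<close>, \<open>g\<close>
    is differentiable at every point of \<Omega>; it is identified with \<open>gradient f\<close>
    only there.\<close>
  define g where "g x = R (D x)" for x
  have F_deriv: "(F has_derivative (\<lambda>h. inner h (g x))) (at x)" if "x \<in> \<Omega>" for x
  proof -
    have "blinfun_apply (D x) = (\<lambda>h. inner h (g x))"
      by (simp add: fun_eq_iff g_def R(2)[symmetric] inner_commute)
    then show ?thesis
      using D[OF that] by simp
  qed
  have gderiv: "GDERIV (\<lambda>y. real_of_ereal (f y)) x :> g x" if "x \<in> \<Omega>" for x
    using F_deriv[OF that] by (simp add: gderiv_def F_def[abs_def])
  have subdiff: "subdifferential f x = {g x}" if "x \<in> \<Omega>" for x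
    using assms(1,3,5) that gderiv[OF that]
    by (intro subdifferential_eq_gradient[of f \<Omega>]) (auto simp: Gamma0_def)
  \<comment> \<open>The definite description needs uniqueness: every candidate gradient is the sole
    element of the subdifferential.\<close>
  have gradient_eq: "gradient f x = g x" if "x \<in> \<Omega>" for x
    unfolding gradient_def
  proof (rule the_equality)
    fix u
    assume "GDERIV (\<lambda>y. real_of_ereal (f y)) x :> u"
    then have "subdifferential f x = {u}"
      using assms(1,3,5) that by (intro subdifferential_eq_gradient[of f \<Omega>]) (auto simp: Gamma0_def)
    then show "u = g x"
      using subdiff[OF that] by simp
  qed (rule gderiv[OF that])
  have g_lipschitz: "\<beta>-lipschitz_on \<Omega> g"
    using assms(9) gradient_eq by (simp add: lipschitz_on_def)

  define S where "S = real_of_ereal (sup_abs f \<Omega>)"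
  define m where "m = real_of_ereal (inf_norm_gradient f \<Omega>)"
  define step where "step x = x - (F x / (norm (g x))\<^sup>2) *\<^sub>R g x" for x
  \<comment> \<open>A point of \<Omega> makes the infimum and the supremum finite, so their real
    coercions \<open>m\<close> and \<open>S\<close> lose nothing. For empty \<Omega> the value of
    \<open>m\<close> is 0.\<close>
  have bounds: "0 < m \<and> m \<le> norm (g x) \<and> F x \<le> S" if "x \<in> \<Omega>" for x
  proof -
    have inf_le: "inf_norm_gradient f \<Omega> \<le> ereal (norm (g x))"
      unfolding inf_norm_gradient_def using that gradient_eq by (metis INF_lower)
    then have "inf_norm_gradient f \<Omega> = ereal m"
      using assms(10) by (cases "inf_norm_gradient f \<Omega>") (auto simp: m_def)
    moreover have le_sup: "\<bar>f x\<bar> \<le> sup_abs f \<Omega>"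
      unfolding sup_abs_def using that by (rule SUP_upper)
    then have "sup_abs f \<Omega> = ereal S"
      using assms(8) f_eq[OF that] by (cases "sup_abs f \<Omega>") (auto simp: S_def)
    ultimately show ?thesis
      using inf_le le_sup assms(10) f_eq[OF that] by auto
  qed
  have S_nonneg: "0 \<le> S"
  proof (cases "\<Omega> = {}")
    case True
    then show ?thesis
      by (simp add: S_def sup_abs_def bot_ereal_def)
  next
    case False
    then show ?thesis
      using bounds F_pos by (meson all_not_in_conv less_imp_le order_trans)
  qed
  define c where "c = S / m\<^sup>2 * \<beta>"
  have "0 \<le> c"
    using S_nonneg assms(6) by (simp add: c_def)

  have step_lipschitz: "norm (step x - step y) \<le> (1 + c) * norm (x - y)"
    if "x \<in> \<Omega>" "y \<in> \<Omega>" for x y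
  proof -
    have "\<exists>G'. (step has_derivative G') (at z) \<and> onorm G' \<le> 1 + c" if z: "z \<in> \<Omega>" for z
    proof -
      have "g z \<noteq> 0"
        using bounds[OF z] by auto
      obtain H where H: "(g has_derivative H) (at z)"
        using D'[OF z] bounded_linear.has_derivative[OF R(1)]
        unfolding g_def[abs_def] differentiable_def by blast
      define G' where "G' h = (h - (inner (g z) h / (norm (g z))\<^sup>2) *\<^sub>R g z) -
        (F z / (norm (g z))\<^sup>2) *\<^sub>R (H h - (2 * inner (g z) (H h) / (norm (g z))\<^sup>2) *\<^sub>R g z)" for h
      have "(step has_derivative G') (at z)"
        unfolding step_def[abs_def] G'_def[abs_def]
        by (rule has_derivative_gradient_step[OF F_deriv[OF z] H \<open>g z \<noteq> 0\<close>])
      moreover have "onorm G' \<le> 1 + c"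
      proof (rule onorm_bound)
        fix h
        have "F z / (norm (g z))\<^sup>2 \<le> S / m\<^sup>2"
          using bounds[OF z] F_pos[OF z] S_nonneg by (intro frac_le power_mono) auto
        moreover have "norm (H h) \<le> \<beta> * norm h"
          by (rule has_derivative_norm_le_lipschitz[OF g_lipschitz assms(3) z H])
        ultimately have "F z / (norm (g z))\<^sup>2 * norm (H h) \<le> S / m\<^sup>2 * (\<beta> * norm h)"
          using F_pos[OF z] S_nonneg by (intro mult_mono) auto
        moreover have "norm (G' h) \<le> norm (h - (inner (g z) h / (norm (g z))\<^sup>2) *\<^sub>R g z) +
            F z / (norm (g z))\<^sup>2 * norm (H h - (2 * inner (g z) (H h) / (norm (g z))\<^sup>2) *\<^sub>R g z)"
          unfolding G'_def using F_pos[OF z]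
          by (intro order_trans[OF norm_triangle_ineq4]) simp
        ultimately show "norm (G' h) \<le> (1 + c) * norm h"
          using norm_diff_projection_le[of h "g z"]
          by (simp add: norm_reflection c_def distrib_right mult.assoc)
      qed (use \<open>0 \<le> c\<close> in simp)
      ultimately show ?thesis
        by blast
    qed
    then obtain G' where "\<And>z. z \<in> \<Omega> \<Longrightarrow> (step has_derivative G' z) (at z)"
      "\<And>z. z \<in> \<Omega> \<Longrightarrow> onorm (G' z) \<le> 1 + c"
      by metis
    \<comment> \<open>The mean value inequality applies because \<Omega> is convex.\<close>
    then show ?thesis
      using differentiable_bound[OF assms(4) _ _ that, of step G' "1 + c"] has_derivative_at_withinI
      by blast
  qed
  have lev_step: "norm (x - step y) \<le> norm (x - y)" if "x \<in> lev_le0 f" "y \<in> \<Omega>" for x y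
  proof -
    \<comment> \<open>The subgradient inequality at \<open>y\<close>, evaluated at \<open>x\<close>,
      puts \<open>x\<close> in the half-space onto which \<open>step\<close> projects
      \<open>y\<close>.\<close>
    have "ereal (F y) + ereal (inner (x - y) (g y)) \<le> f x"
      using subdiff[OF that(2)] f_eq[OF that(2)] unfolding subdifferential_def by auto
    also have "\<dots> \<le> 0"
      using that(1) by (simp add: lev_le0_def)
    finally have "inner (g y) (x - y) \<le> - F y"
      by (simp add: inner_commute)
    then have "norm ((x - y) + (F y / (norm (g y))\<^sup>2) *\<^sub>R g y) \<le> norm (x - y)"
      using F_pos[OF that(2)] by (intro norm_add_halfspace_step_le) auto
    then show ?thesis
      by (simp add: step_def algebra_simps)
  qed

  define G where "G x = (if f x \<le> 0 then x else step x)" for x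
  have G_lev: "G x = x" if "x \<in> lev_le0 f" for x
    using that by (simp add: G_def lev_le0_def)
  have G_\<Omega>: "G x = step x" if "x \<in> \<Omega>" for x
    using F_pos[OF that] f_eq[OF that] by (simp add: G_def)
  have "subgradient_projector f x = {G x}" if "x \<in> lev_le0 f \<union> \<Omega>" for x
  proof (cases "x \<in> \<Omega>")
    case True
    then show ?thesis
      using F_pos[OF True] f_eq[OF True]
      by (simp add: subgradient_projector_def subdiff G_\<Omega> step_def)
  next
    case False
    then show ?thesis
      using that by (auto simp: subgradient_projector_def G_lev lev_le0_def)
  qed
  \<comment> \<open>The union need not be convex, so mixed pairs are handled by
    \<open>lev_step\<close> instead of the mean value inequality; on the level set \<open>G\<close>
    is the identity.\<close>
  moreover have "(1 + c)-lipschitz_on (lev_le0 f \<union> \<Omega>) G"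
  proof (rule lipschitz_onI)
    fix x y
    assume "x \<in> lev_le0 f \<union> \<Omega>" "y \<in> lev_le0 f \<union> \<Omega>"
    moreover have "norm (x - y) \<le> (1 + c) * norm (x - y)"
      using \<open>0 \<le> c\<close> by (simp add: distrib_right)
    ultimately show "dist (G x) (G y) \<le> (1 + c) * dist x y"
      using step_lipschitz[of x y] lev_step[of x y] lev_step[of y x]
      by (auto simp: dist_norm G_lev G_\<Omega> norm_minus_commute)
  qed (use \<open>0 \<le> c\<close> in simp)
  moreover have "lipschitz_bound f \<Omega> \<beta> = 2 + 3 * c"
    by (simp add: lipschitz_bound_def c_def S_def m_def)
  \<comment> \<open>The constant 1 + c is sharper than the claimed 2 + 3c, which is what plain
    triangle inequalities for the projection and reflection terms would give.\<close>
  then have "1 + c \<le> lipschitz_bound f \<Omega> \<beta>"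
    using \<open>0 \<le> c\<close> by simp
  ultimately show ?thesis
    using lipschitz_on_le by blast
qed

end
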